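(* For every matrix composition $\mathbf{a}\in\mathrm{Cmp}$, the function $$\Psi_{\mathbf{a}}:\mathrm{evC}\to\mathbb{K},\qquad X\mapsto\langle\mathsf{SS}(\delta X),\mathbf{a}\rangle$$ is invariant modulo constants, i.e. $\Psi_{\mathbf{a}}(X+C)=\Psi_{\mathbf{a}}(X)$ for all $X\in\mathrm{evC}$ and all constant functions $C\in\mathrm{evC}$, and invariant to warping in both directions independently, i.e. $\Psi_{\mathbf{a}}\circ\mathsf{warp}_{a,k}=\Psi_{\mathbf{a}}$ for all $(a,k)\in\{1,2\}\times\mathbb{N}$.
   Context: $\mathbb{K}$ is an integral domain, $\mathbb{N}=\{1,2,\ldots\}$, $d\in\mathbb{N}$ is fixed; $\mathbb{N}^2$ carries the product order. $(\mathfrak{M}_d,\star,\varepsilon)$ is the free commutative monoid generated by $d$ letters $\mathbf{1},\ldots,\mathbf{d}$. A non-empty matrix composition is a matrix $\mathbf{a}\in\mathfrak{M}_d^{m\times n}$ ($m,n\geq1$) such that no row and no column consists only of entries $\varepsilon$. $\mathrm{Cmp}$ is the set of all these matrices together with an additional element $\mathsf{e}$, the empty composition. $\mathrm{evC}$ is the $\mathbb{K}$-module of eventually constant functions $X:\mathbb{N}^2\to\mathbb{K}^d$, i.e. those for which there is $\boldsymbol{n}\in\mathbb{N}^2$ such that $X$ is constant on $\{\boldsymbol{i}\in\mathbb{N}^2\mid\boldsymbol{i}\not\leq\boldsymbol{n}\}$. $\mathrm{evZ}\subseteq\mathrm{evC}$ is the submodule of functions of finite support. For $(a,k)\in\{1,2\}\times\mathbb{N}$,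 the warping operation $\mathsf{warp}_{a,k}:\mathrm{evC}\to\mathrm{evC}$ is $(\mathsf{warp}_{a,k}X)_{\boldsymbol{i}}=X_{\boldsymbol{i}}$ if $\boldsymbol{i}_a\leq k$ and $X_{\boldsymbol{i}-e_a}$ if $\boldsymbol{i}_a>k$ ($e_a$ the $a$-th standard unit vector). The difference operator $\delta:\mathrm{evC}\to\mathrm{evZ}$ is $(\delta X)_{i,j}=X_{i+1,j+1}-X_{i+1,j}-X_{i,j+1}+X_{i,j}$. For $z\in\mathbb{K}^d$, $\lambda\mapsto z^{(\lambda)}$ is the monoid homomorphism from $\mathfrak{M}_d$ to the multiplicative monoid of $\mathbb{K}$ with $z^{(\mathbf{j})}=z_j$ for every letter $\mathbf{j}$. For $Z\in\mathrm{evZ}$ and non-empty $\mathbf{a}\in\mathrm{Cmp}$ of size $m\times n$, $$\langle\mathsf{SS}(Z),\mathbf{a}\rangle=\sum_{\substack{1\leq\iota_1<\cdots<\iota_m\\1\leq\kappa_1<\cdots<\kappa_n}}\ \prod_{s=1}^{m}\prod_{t=1}^{n}Z_{\iota_s,\kappa_t}^{(\mathbf{a}_{s,t})}$$ (a sum with finitely many non-zero terms), and $\langle\mathsf{SS}(Z),\mathsf{e}\rangle=1$. *)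

theory Defs
  imports
    "Jordan_Normal_Form.Matrix"
    "HOL-Library.Multiset"
    "HOL-Analysis.Analysis"
begin

text \<open>
  Throughout, the natural numbers start at 1.  A function on \<open>\<nat>\<^sup>2\<close> is represented by a
  function on \<^typ>\<open>nat \<times> nat\<close> of which only the values on \<open>NN\<close> are meaningful; all notions below
  ignore the other values.  The order on pairs is the componentwise one, and so is the
  subtraction of pairs.
\<close>

definition NN :: "(nat \<times> nat) set" where
  "NN = {1..} \<times> {1..}"

definition evC :: "(nat \<times> nat \<Rightarrow> 'k::idom ^ 'd::finite) set" where
  "evC = {X. \<exists>n\<in>NN. X constant_on {i\<in>NN. \<not> i \<le> n}}"

definition evZ :: "(nat \<times> nat \<Rightarrow> 'k::idom ^ 'd::finite) set" where
  "evZ = {Z \<in> evC. finite {i\<in>NN. Z i \<noteq> 0}}"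

definition coord :: "nat \<Rightarrow> nat \<times> nat \<Rightarrow> nat" where
  "coord a i = (if a = 1 then fst i else snd i)"

definition unit_pair :: "nat \<Rightarrow> nat \<times> nat" where
  "unit_pair a = (if a = 1 then (1, 0) else (0, 1))"

definition warp :: "nat \<Rightarrow> nat \<Rightarrow> (nat \<times> nat \<Rightarrow> 'v) \<Rightarrow> nat \<times> nat \<Rightarrow> 'v" where
  "warp a k X = (\<lambda>i. if coord a i \<le> k then X i else X (i - unit_pair a))"

definition delta :: "(nat \<times> nat \<Rightarrow> 'v::ab_group_add) \<Rightarrow> nat \<times> nat \<Rightarrow> 'v" where
  "delta X = (\<lambda>(i, j). X (i+1, j+1) - X (i+1, j) - X (i, j+1) + X (i, j))"

text \<open>
  The free commutative monoid on \<open>d\<close> letters is the type of multisets over an alphabet \<open>'d\<close>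
  with \<open>d\<close> elements; its unit is \<open>{#}\<close>.  The constructor \<^const>\<open>None\<close> is the empty composition;
  entries of a matrix are indexed from 0.
\<close>

definition Cmp :: "'d multiset mat option set" where
  "Cmp = insert None (Some ` {A. dim_row A \<ge> 1 \<and> dim_col A \<ge> 1
     \<and> (\<forall>s<dim_row A. \<exists>t<dim_col A. A $$ (s, t) \<noteq> {#})
     \<and> (\<forall>t<dim_col A. \<exists>s<dim_row A. A $$ (s, t) \<noteq> {#})})"

definition mon_eval :: "'k::idom ^ 'd \<Rightarrow> 'd multiset \<Rightarrow> 'k" where
  "mon_eval z l = prod_mset (image_mset (vec_nth z) l)"

definition incr_seqs :: "nat \<Rightarrow> nat list set" where
  "incr_seqs m = {\<iota>. length \<iota> = m \<and> sorted_wrt (<) \<iota> \<and> set \<iota> \<subseteq> {1..}}"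

definition SS_term ::
  "(nat \<times> nat \<Rightarrow> 'k::idom ^ 'd) \<Rightarrow> 'd multiset mat \<Rightarrow> nat list \<times> nat list \<Rightarrow> 'k" where
  "SS_term Z A = (\<lambda>(\<iota>, \<kappa>).
     \<Prod>s<dim_row A. \<Prod>t<dim_col A. mon_eval (Z (\<iota> ! s, \<kappa> ! t)) (A $$ (s, t)))"

text \<open>
  The index set of the sum is infinite, so the sum is restricted to its non-zero terms;
  these are finitely many by lemma \<open>finite_SS_terms\<close> below.
\<close>

fun SS :: "(nat \<times> nat \<Rightarrow> 'k::idom ^ 'd) \<Rightarrow> 'd multiset mat option \<Rightarrow> 'k" where
  "SS Z None = 1"
| "SS Z (Some A) =
     (\<Sum>p \<in> {p \<in> incr_seqs (dim_row A) \<times> incr_seqs (dim_col A). SS_term Z A p \<noteq> 0}. SS_term Z A p)"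

definition Psi :: "'d multiset mat option \<Rightarrow> (nat \<times> nat \<Rightarrow> 'k::idom ^ 'd) \<Rightarrow> 'k" where
  "Psi a X = SS (delta X) a"

lemma mon_eval_empty: "mon_eval z {#} = 1"
  and mon_eval_add: "mon_eval z (l + l') = mon_eval z l * mon_eval z l'"
  and mon_eval_letter: "mon_eval z {#j#} = vec_nth z j"
  by (simp_all add: mon_eval_def)

lemma mon_eval_zero: "l \<noteq> {#} \<Longrightarrow> mon_eval 0 l = 0"
  by (auto simp: mon_eval_def dest: multi_nonempty_split)

lemma finite_SS_terms:
  fixes Z :: "nat \<times> nat \<Rightarrow> 'k::idom ^ 'd::finite"
  assumes "Z \<in> evZ" and "Some A \<in> Cmp"
  shows "finite {p \<in> incr_seqs (dim_row A) \<times> incr_seqs (dim_col A). SS_term Z A p \<noteq> 0}"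
proof -
  let ?S = "{i\<in>NN. Z i \<noteq> 0}"
  have fin: "finite ?S" using assms(1) by (simp add: evZ_def)
  have A: "\<forall>s<dim_row A. \<exists>t<dim_col A. A $$ (s, t) \<noteq> {#}"
    "\<forall>t<dim_col A. \<exists>s<dim_row A. A $$ (s, t) \<noteq> {#}"
    using assms(2) by (auto simp: Cmp_def)
  let ?L = "{xs. set xs \<subseteq> fst ` ?S \<and> length xs = dim_row A}"
  let ?R = "{xs. set xs \<subseteq> snd ` ?S \<and> length xs = dim_col A}"
  have "{p \<in> incr_seqs (dim_row A) \<times> incr_seqs (dim_col A). SS_term Z A p \<noteq> 0} \<subseteq> ?L \<times> ?R"
  proof (rule subrelI)
    fix x y assume "(x, y) \<in> {p \<in> incr_seqs (dim_row A) \<times> incr_seqs (dim_col A). SS_term Z A p \<noteq> 0}"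
    then have x: "x \<in> incr_seqs (dim_row A)" and y: "y \<in> incr_seqs (dim_col A)"
      and nz: "SS_term Z A (x, y) \<noteq> 0" by auto
    have lx: "length x = dim_row A" "set x \<subseteq> {1..}" and ly: "length y = dim_col A" "set y \<subseteq> {1..}"
      using x y by (auto simp: incr_seqs_def)
    have ent: "mon_eval (Z (x ! s, y ! t)) (A $$ (s, t)) \<noteq> 0"
      if "s < dim_row A" "t < dim_col A" for s t
      using nz that by (auto simp: SS_term_def)
    have mem: "(x ! s, y ! t) \<in> ?S"
      if "s < dim_row A" "t < dim_col A" "A $$ (s, t) \<noteq> {#}" for s t
    proof -
      have "x ! s \<in> set x" "y ! t \<in> set y" using that lx ly by auto
      then have "(x ! s, y ! t) \<in> NN" using lx ly by (auto simp: NN_def)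
      moreover have "Z (x ! s, y ! t) \<noteq> 0" using ent[OF that(1,2)] mon_eval_zero[OF that(3)] by metis
      ultimately show ?thesis by simp
    qed
    have "set x \<subseteq> fst ` ?S"
    proof
      fix v assume "v \<in> set x"
      then obtain s where s: "s < dim_row A" "v = x ! s" using lx by (auto simp: in_set_conv_nth)
      with A obtain t where "t < dim_col A" "A $$ (s, t) \<noteq> {#}" by blast
      from mem[OF s(1) this] show "v \<in> fst ` ?S" using s by force
    qed
    moreover have "set y \<subseteq> snd ` ?S"
    proof
      fix v assume "v \<in> set y"
      then obtain t where t: "t < dim_col A" "v = y ! t" using ly by (auto simp: in_set_conv_nth)
      with A obtain s where s: "s < dim_row A" "A $$ (s, t) \<noteq> {#}" by blast
      from mem[OF s(1) t(1) s(2)] show "v \<in> snd ` ?S" using t by force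
    qed
    ultimately show "(x, y) \<in> ?L \<times> ?R" using lx ly by simp
  qed
  moreover have "finite (?L \<times> ?R)"
    by (intro finite_cartesian_product finite_lists_length_eq finite_imageI fin)
  ultimately show ?thesis by (rule finite_subset)
qed

lemma delta_evZ:
  fixes X :: "nat \<times> nat \<Rightarrow> 'k::idom ^ 'd::finite"
  assumes "X \<in> evC"
  shows "delta X \<in> evZ"
proof -
  obtain n c where n: "n \<in> NN" and c: "\<And>i. i \<in> NN \<Longrightarrow> \<not> i \<le> n \<Longrightarrow> X i = c"
    using assms by (auto simp: evC_def constant_on_def)
  have z: "delta X i = 0" if "i \<in> NN" "\<not> i \<le> n" for i
  proof -
    obtain p q where i: "i = (p, q)" by force
    have "X (p+1, q+1) = c" "X (p+1, q) = c" "X (p, q+1) = c" "X (p, q) = c"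
      using that i by (auto intro!: c simp: NN_def less_eq_prod_def)
    then show ?thesis by (simp add: delta_def i)
  qed
  have "{i\<in>NN. delta X i \<noteq> 0} \<subseteq> {1..fst n} \<times> {1..snd n}"
  proof
    fix i assume i: "i \<in> {i\<in>NN. delta X i \<noteq> 0}"
    then have "i \<le> n" using z by blast
    with i show "i \<in> {1..fst n} \<times> {1..snd n}"
      by (cases i) (auto simp: NN_def less_eq_prod_def)
  qed
  then have "finite {i\<in>NN. delta X i \<noteq> 0}" by (rule finite_subset) auto
  moreover have "delta X \<in> evC"
    using n z by (auto simp: evC_def constant_on_def)
  ultimately show ?thesis by (simp add: evZ_def)
qed

lemma warp_evC:
  fixes X :: "nat \<times> nat \<Rightarrow> 'k::idom ^ 'd::finite"
  assumes "X \<in> evC" "a \<in> {1, 2}" "k \<in> {1..}"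
  shows "warp a k X \<in> evC"
proof -
  obtain n c where n: "n \<in> NN" and c: "\<And>i. i \<in> NN \<Longrightarrow> \<not> i \<le> n \<Longrightarrow> X i = c"
    using assms by (auto simp: evC_def constant_on_def)
  define n' where "n' = (fst n + k + 1, snd n + k + 1)"
  have "warp a k X i = c" if "i \<in> NN" "\<not> i \<le> n'" for i
    using that assms(2,3)
    by (cases i) (auto simp: warp_def n'_def coord_def unit_pair_def NN_def less_eq_prod_def
        intro!: c)
  then have "warp a k X constant_on {i\<in>NN. \<not> i \<le> n'}" by (auto simp: constant_on_def)
  moreover have "n' \<in> NN" by (auto simp: n'_def NN_def)
  ultimately show ?thesis unfolding evC_def by blast
qed

end

theory Submission
  imports Defs
begin

text \<open>
  The sum \<^term>\<open>SS Z a\<close> does not see zero rows or zero columns of \<^term>\<open>Z\<close>: every row of a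
  matrix composition has a nonempty entry, so a summand whose row indices include a zero row of
  \<^term>\<open>Z\<close> has a factor \<open>0\<close>, and likewise for columns.  Deleting or inserting zero
  rows and columns therefore only relabels the nonzero summands
  (\<open>SS_zero_insertion\<close>).

  Both invariances reduce to this.  The difference operator kills constants, so adding a constant
  does not change \<^term>\<open>delta X\<close> on \<^const>\<open>NN\<close>.  Warping repeats a row (or a column) of \<^term>\<open>X\<close>,
  and the difference of two equal neighbouring rows is zero; hence \<^term>\<open>delta (warp r k X)\<close> arises
  from \<^term>\<open>delta X\<close> by inserting one zero row or column at position \<^term>\<open>k\<close>.
\<close>

lemma strict_mono_image_positive:
  fixes f :: "nat \<Rightarrow> nat"
  assumes "strict_mono f" "1 \<le> n"
  shows "1 \<le> f n"
  using strict_mono_imp_increasing[OF assms(1), of n] assms(2) by linarith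

lemma map_in_incr_seqs_iff:
  assumes "strict_mono f" "set xs \<subseteq> {1..}"
  shows "map f xs \<in> incr_seqs m \<longleftrightarrow> xs \<in> incr_seqs m"
  using assms
  by (auto simp: incr_seqs_def sorted_wrt_map strict_mono_less subset_iff
      intro: strict_mono_image_positive[simplified])

lemma nth_pair_in_NN:
  assumes "x \<in> incr_seqs m" "y \<in> incr_seqs n" "s < m" "t < n"
  shows "(x ! s, y ! t) \<in> NN"
proof -
  have "s < length x" "t < length y" "set x \<subseteq> {1..}" "set y \<subseteq> {1..}"
    using assms by (auto simp: incr_seqs_def)
  then have "x ! s \<in> {1..}" "y ! t \<in> {1..}" by (meson nth_mem subsetD)+
  then show ?thesis by (simp add: NN_def)
qed

lemma SS_term_nonzero_entry:
  assumes "SS_term Z A (x, y) \<noteq> 0" "s < dim_row A" "t < dim_col A" "A $$ (s, t) \<noteq> {#}"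
  shows "Z (x ! s, y ! t) \<noteq> 0"
proof -
  have "mon_eval (Z (x ! s, y ! t)) (A $$ (s, t)) \<noteq> 0"
    using assms(1-3) by (auto simp: SS_term_def)
  then show ?thesis using mon_eval_zero[OF assms(4)] by metis
qed

text \<open>
  The strictly increasing maps \<^term>\<open>f\<close> and \<^term>\<open>g\<close> give the new positions of the old rows and
  columns.  Applying them to the index sequences is an injection that preserves summands; it
  reaches every nonzero summand because each chosen row meets a nonempty entry of the
  composition, where \<^term>\<open>Z'\<close> must be nonzero, and so each chosen row is an old one.
\<close>

lemma SS_zero_insertion:
  fixes Z Z' :: "nat \<times> nat \<Rightarrow> 'k::idom ^ 'd::finite"
  assumes a: "a \<in> Cmp"
    and f: "strict_mono f" and g: "strict_mono g"
    and moved: "\<And>i. i \<in> NN \<Longrightarrow> Z' (map_prod f g i) = Z i"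
    and inserted: "\<And>i. i \<in> NN \<Longrightarrow> i \<notin> map_prod f g ` NN \<Longrightarrow> Z' i = 0"
  shows "SS Z' a = SS Z a"
proof (cases a)
  case None
  then show ?thesis by simp
next
  case (Some A)
  have rows: "\<exists>t<dim_col A. A $$ (s, t) \<noteq> {#}" if "s < dim_row A" for s
    using a that by (auto simp: Some Cmp_def)
  have cols: "\<exists>s<dim_row A. A $$ (s, t) \<noteq> {#}" if "t < dim_col A" for t
    using a that by (auto simp: Some Cmp_def)
  let ?I = "incr_seqs (dim_row A) \<times> incr_seqs (dim_col A)"
  let ?S = "\<lambda>Z. {p \<in> ?I. SS_term Z A p \<noteq> 0}"
  let ?h = "map_prod (map f) (map g)"
  have summand: "SS_term Z' A (?h p) = SS_term Z A p" if "p \<in> ?I" for p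
  proof -
    obtain x y where p: "p = (x, y)" by force
    have x: "x \<in> incr_seqs (dim_row A)" and y: "y \<in> incr_seqs (dim_col A)"
      using that p by auto
    have "Z' (map f x ! s, map g y ! t) = Z (x ! s, y ! t)"
      if "s < dim_row A" "t < dim_col A" for s t
      using moved[OF nth_pair_in_NN[OF x y that]] that x y by (simp add: incr_seqs_def)
    then show ?thesis by (simp add: p SS_term_def)
  qed
  have "bij_betw ?h (?S Z) (?S Z')"
  proof (rule bij_betw_imageI)
    have "inj ?h" using f g by (intro prod.inj_map) (auto intro: strict_mono_imp_inj_on)
    then show "inj_on ?h (?S Z)" by (rule inj_on_subset) simp
    show "?h ` ?S Z = ?S Z'"
    proof (intro equalityI subsetI)
      fix q assume "q \<in> ?h ` ?S Z"
      then obtain p where p: "p \<in> ?I" "SS_term Z A p \<noteq> 0" "q = ?h p" by auto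
      obtain x y where xy: "p = (x, y)" by force
      have "set x \<subseteq> {1..}" "set y \<subseteq> {1..}" using p(1) xy by (auto simp: incr_seqs_def)
      then have "q \<in> ?I"
        using p(1,3) xy map_in_incr_seqs_iff[OF f] map_in_incr_seqs_iff[OF g] by simp
      then show "q \<in> ?S Z'" using summand p by simp
    next
      fix q assume q: "q \<in> ?S Z'"
      obtain x' y' where xy': "q = (x', y')" by force
      have x': "x' \<in> incr_seqs (dim_row A)" and y': "y' \<in> incr_seqs (dim_col A)"
        and nz: "SS_term Z' A (x', y') \<noteq> 0" using q xy' by auto
      have len: "length x' = dim_row A" "length y' = dim_col A"
        using x' y' by (auto simp: incr_seqs_def)
      have old: "x' ! s \<in> f ` {1..} \<and> y' ! t \<in> g ` {1..}"
        if "s < dim_row A" "t < dim_col A" "A $$ (s, t) \<noteq> {#}" for s t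
      proof -
        have "(x' ! s, y' ! t) \<in> map_prod f g ` NN"
          using inserted[OF nth_pair_in_NN[OF x' y' that(1,2)]] SS_term_nonzero_entry[OF nz that]
          by blast
        then show ?thesis by (auto simp: NN_def)
      qed
      have "x' ! s \<in> f ` {1..}" if "s < dim_row A" for s
        using rows[OF that] old[OF that] by blast
      then have "set x' \<subseteq> f ` {1..}" by (metis in_set_conv_nth len(1) subsetI)
      moreover have "y' ! t \<in> g ` {1..}" if "t < dim_col A" for t
        using cols[OF that] old[OF _ that] by blast
      then have "set y' \<subseteq> g ` {1..}" by (metis in_set_conv_nth len(2) subsetI)
      ultimately have "x' \<in> map f ` lists {1..}" "y' \<in> map g ` lists {1..}"
        by (simp_all only: lists_image[symmetric] in_lists_conv_set subset_iff)
          blast+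
      then obtain x y where x: "x' = map f x" "set x \<subseteq> {1..}" and y: "y' = map g y" "set y \<subseteq> {1..}"
        by auto
      have "(x, y) \<in> ?I"
        using x' y' x y map_in_incr_seqs_iff[OF f x(2)] map_in_incr_seqs_iff[OF g y(2)] by auto
      moreover have "q = ?h (x, y)" using xy' x y by simp
      ultimately show "q \<in> ?h ` ?S Z" using summand[of "(x, y)"] nz xy' by force
    qed
  qed
  then have "(\<Sum>p\<in>?S Z. SS_term Z' A (?h p)) = (\<Sum>p\<in>?S Z'. SS_term Z' A p)"
    by (rule sum.reindex_bij_betw)
  moreover have "(\<Sum>p\<in>?S Z. SS_term Z' A (?h p)) = (\<Sum>p\<in>?S Z. SS_term Z A p)"
    by (rule sum.cong) (simp_all add: summand)
  ultimately show ?thesis by (simp add: Some)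
qed

lemma SS_cong:
  fixes Z Z' :: "nat \<times> nat \<Rightarrow> 'k::idom ^ 'd::finite"
  assumes "a \<in> Cmp" "\<And>i. i \<in> NN \<Longrightarrow> Z' i = Z i"
  shows "SS Z' a = SS Z a"
  using assms
  by (intro SS_zero_insertion[where f = "\<lambda>i. i" and g = "\<lambda>i. i"])
    (auto simp: strict_mono_def map_prod_ident)

lemma delta_add_constant:
  assumes "C constant_on NN" "i \<in> NN"
  shows "delta (\<lambda>i. X i + C i) i = delta X i"
proof -
  obtain c where "\<And>i. i \<in> NN \<Longrightarrow> C i = c" using assms(1) by (auto simp: constant_on_def)
  then show ?thesis using assms(2) by (cases i) (simp add: delta_def NN_def)
qed

definition skip :: "nat \<Rightarrow> nat \<Rightarrow> nat" where
  "skip k n = (if n < k then n else Suc n)"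

lemma strict_mono_skip: "strict_mono (skip k)"
  by (auto simp: strict_mono_def skip_def)

lemma in_skip_image_positive:
  assumes "1 \<le> k" "1 \<le> n" "n \<noteq> k"
  shows "n \<in> skip k ` {1..}"
proof (cases "n < k")
  case True
  then show ?thesis using assms by (intro image_eqI[of _ _ n]) (auto simp: skip_def)
next
  case False
  then show ?thesis using assms by (intro image_eqI[of _ _ "n - 1"]) (auto simp: skip_def)
qed

text \<open>
  Old row \<open>k - 1\<close> is a difference of the rows \<open>k\<close> and \<open>k - 1\<close>, which the warping leaves in
  place, whereas old row \<open>k\<close> is a difference of the rows \<open>k + 1\<close> and \<open>k\<close>, which now sit at
  \<open>k + 2\<close> and \<open>k + 1\<close>.  This is why the differences jump over \<open>k\<close> itself.
\<close>

lemma delta_warp_skip: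
  shows "delta (warp 1 k X) (skip k i, j) = delta X (i, j)"
    and "delta (warp 2 k X) (i, skip k j) = delta X (i, j)"
  by (auto simp: delta_def warp_def coord_def unit_pair_def skip_def)

lemma delta_warp_zero:
  shows "delta (warp 1 k X) (k, j) = 0"
    and "delta (warp 2 k X) (i, k) = 0"
  by (auto simp: delta_def warp_def coord_def unit_pair_def)

lemma Psi_warp:
  fixes X :: "nat \<times> nat \<Rightarrow> 'k::idom ^ 'd::finite"
  assumes a: "a \<in> Cmp" and r: "r \<in> {1, 2}" and k: "1 \<le> k"
  shows "Psi a (warp r k X) = Psi a X"
proof -
  let ?f = "if r = 1 then skip k else (\<lambda>i. i)"
  let ?g = "if r = 1 then (\<lambda>i. i) else skip k"
  show ?thesis unfolding Psi_def
  proof (rule SS_zero_insertion[OF a, of ?f ?g])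
    show "strict_mono ?f" "strict_mono ?g"
      using strict_mono_skip by (auto simp: strict_mono_def)
    fix i assume i: "i \<in> NN"
    show "delta (warp r k X) (map_prod ?f ?g i) = delta X i"
      using r by (cases i) (auto simp: delta_warp_skip[simplified])
    assume new: "i \<notin> map_prod ?f ?g ` NN"
    have "coord r i = k"
    proof (rule ccontr)
      assume "coord r i \<noteq> k"
      then have "coord r i \<in> skip k ` {1..}"
        using i k by (intro in_skip_image_positive) (auto simp: NN_def coord_def)
      moreover have "map_prod ?f ?g ` NN = (?f ` {1..}) \<times> (?g ` {1..})"
        unfolding NN_def by (rule map_prod_surj_on) simp_all
      ultimately have "i \<in> map_prod ?f ?g ` NN"
        using i by (cases i) (simp add: NN_def coord_def split: if_splits)
      with new show False ..
    qed
    then show "delta (warp r k X) i = 0"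
      using r by (cases i) (auto simp: coord_def delta_warp_zero[simplified])
  qed
qed

theorem corollary2p26:
  fixes a :: "'d::finite multiset mat option"
  assumes "a \<in> Cmp"
  shows "(\<forall>X \<in> (evC :: (nat \<times> nat \<Rightarrow> 'k::idom ^ 'd) set). \<forall>C \<in> evC.
            C constant_on NN \<longrightarrow> Psi a (\<lambda>i. X i + C i) = Psi a X)
       \<and> (\<forall>X \<in> (evC :: (nat \<times> nat \<Rightarrow> 'k ^ 'd) set). \<forall>r \<in> {1, 2}. \<forall>k \<in> {1..}.
            Psi a (warp r k X) = Psi a X)"
proof (intro conjI ballI impI)
  fix X C :: "nat \<times> nat \<Rightarrow> 'k ^ 'd"
  assume "C constant_on NN"
  then show "Psi a (\<lambda>i. X i + C i) = Psi a X"
    unfolding Psi_def by (intro SS_cong[OF assms] delta_add_constant)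
next
  fix X :: "nat \<times> nat \<Rightarrow> 'k ^ 'd" and r k :: nat
  assume "r \<in> {1, 2}" "k \<in> {1..}"
  then show "Psi a (warp r k X) = Psi a X" by (intro Psi_warp[OF assms]) auto
qed

end
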